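(* Let $G$ be a $d$-regular graph with $e(G)$ edges, and for $m\in\{d,d-2,\dots,-d\}$ let $Q_{(m)}(x_0,\dots,x_d)$ be the linear form satisfying $\partial Q_{(m)}=mi\cdot Q_{(m)}$, normalized so that the coefficient of $x_0$ is $1$. Then $$F_G(x_0,\dots ,x_d)=\frac{1}{2^{e(G)}}\sum_{\mathcal{O}}\prod_{v\in V(G)}Q_{(d_{\mathcal{O}}(v))}(x_0,\dots,x_d),$$ where the sum runs over all orientations $\mathcal{O}$ of the edges of $G$.
   Context: Here $i=\sqrt{-1}$ and graphs are finite. For a $d$-regular graph $G$, the subgraph counting polynomial is $$F_G(x_0,x_1,\dots ,x_d)=\sum_{A \subseteq E(G)}\prod_{v\in V(G)}x_{d_A(v)},$$ where $d_A(v)$ is the degree of $v$ in the subgraph $(V(G),A)$. The derivation $\partial$ of $\mathbb{C}[x_0,\dots,x_d]$ is $\partial P=\sum_{k=0}^d\left((d-k)x_{k+1}-kx_{k-1}\right)\frac{\partial P}{\partial x_k}$, where the terms $(d-k)x_{k+1}$ for $k=d$ and $kx_{k-1}$ for $k=0$ are $0$; on the space of linear forms in $x_0,\dots,x_d$ it has the $d+1$ distinct eigenvalues $mi$, $m\in\{d,d-2,\dots,-d\}$. Given an orientation $\mathcal{O}$ of the edges, the oriented degree $d_{\mathcal{O}}(v)$ is the out-degree minus the in-degree of the vertex $v$. *)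

theory Defs
  imports Complex_Main "HOL-Library.FuncSet" "HOL-Library.Poly_Mapping"
begin

text \<open>Finite graphs without loops. Edges are carried by a type of their own, so parallel edges are
  allowed; simple graphs are the case where \<open>ends\<close> is injective on the edges.\<close>

record ('v, 'e) graph =
  verts :: "'v set"
  edges :: "'e set"
  ends :: "'e \<Rightarrow> 'v set"

definition finite_graph :: "('v, 'e) graph \<Rightarrow> bool" where
  "finite_graph G \<longleftrightarrow> finite (verts G) \<and> finite (edges G) \<and>
     (\<forall>e\<in>edges G. ends G e \<subseteq> verts G \<and> card (ends G e) = 2)"

definition degree_in :: "('v, 'e) graph \<Rightarrow> 'e set \<Rightarrow> 'v \<Rightarrow> nat" where
  "degree_in G A v = card {e \<in> A. v \<in> ends G e}"

definition regular :: "nat \<Rightarrow> ('v, 'e) graph \<Rightarrow> bool" where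
  "regular d G \<longleftrightarrow> (\<forall>v\<in>verts G. degree_in G (edges G) v = d)"

text \<open>An orientation assigns to every edge an ordered pair (tail, head) of its two ends. It is
  \<open>undefined\<close> off the edge set, so that distinct functions are distinct orientations.\<close>

definition orientations :: "('v, 'e) graph \<Rightarrow> ('e \<Rightarrow> 'v \<times> 'v) set" where
  "orientations G = (\<Pi>\<^sub>E e\<in>edges G. {(u, v). ends G e = {u, v}})"

definition oriented_degree :: "('v, 'e) graph \<Rightarrow> ('e \<Rightarrow> 'v \<times> 'v) \<Rightarrow> 'v \<Rightarrow> int" where
  "oriented_degree G \<O> v =
     int (card {e \<in> edges G. fst (\<O> e) = v}) - int (card {e \<in> edges G. snd (\<O> e) = v})"

text \<open>Complex polynomials in variables \<open>x\<^sub>0, x\<^sub>1, \<dots>\<close>, as finitely supported coefficient functions on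
  exponent vectors. The ring in the variables \<open>x\<^sub>0, \<dots>, x\<^sub>d\<close> is regarded as a subring.\<close>

type_synonym cpoly = "(nat \<Rightarrow>\<^sub>0 nat) \<Rightarrow>\<^sub>0 complex"

definition const :: "complex \<Rightarrow> cpoly" where
  "const c = Poly_Mapping.single 0 c"

definition var :: "nat \<Rightarrow> cpoly" where
  "var k = Poly_Mapping.single (Poly_Mapping.single k 1) 1"

text \<open>If \<open>x\<^sub>k\<close> does not occur in the monomial \<open>m\<close>, the truncated exponent is harmless because the
  coefficient is \<open>0\<close>.\<close>

definition partial_deriv :: "nat \<Rightarrow> cpoly \<Rightarrow> cpoly" where
  "partial_deriv k P = (\<Sum>m\<in>Poly_Mapping.keys P.
     Poly_Mapping.single (m - Poly_Mapping.single k 1)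
       (of_nat (Poly_Mapping.lookup m k) * Poly_Mapping.lookup P m))"

text \<open>The terms with \<open>x\<^sub>d\<^sub>+\<^sub>1\<close> (for \<open>k = d\<close>) and \<open>var (0 - 1)\<close> (for \<open>k = 0\<close>) have coefficient \<open>0\<close>.\<close>

definition derivation :: "nat \<Rightarrow> cpoly \<Rightarrow> cpoly" where
  "derivation d P = (\<Sum>k\<le>d.
     (const (of_nat (d - k)) * var (k + 1) - const (of_nat k) * var (k - 1)) * partial_deriv k P)"

definition linear_form :: "nat \<Rightarrow> cpoly \<Rightarrow> bool" where
  "linear_form d Q \<longleftrightarrow> (\<exists>c :: nat \<Rightarrow> complex. Q = (\<Sum>k\<le>d. const (c k) * var k))"

definition is_eigenform :: "nat \<Rightarrow> int \<Rightarrow> cpoly \<Rightarrow> bool" where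
  "is_eigenform d m Q \<longleftrightarrow> linear_form d Q \<and>
     derivation d Q = const (of_int m * \<i>) * Q \<and>
     Poly_Mapping.lookup Q (Poly_Mapping.single 0 1) = 1"

text \<open>Meaningful for \<open>m \<in> {d, d - 2, \<dots>, -d}\<close>, where there is exactly one such form.\<close>

definition eigenform :: "nat \<Rightarrow> int \<Rightarrow> cpoly" where
  "eigenform d m = (THE Q. is_eigenform d m Q)"

definition subgraph_poly :: "('v, 'e) graph \<Rightarrow> cpoly" where
  "subgraph_poly G = (\<Sum>A\<in>Pow (edges G). \<Prod>v\<in>verts G. var (degree_in G A v))"

end

theory Submission
  imports Defs "HOL-Computational_Algebra.Polynomial"
begin

text \<open>A linear form with coefficients \<open>c\<^sub>k\<close> is an eigenform for \<open>m\<i>\<close> iff the generating function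
  \<open>p = \<Sum> c\<^sub>k t\<^sup>k\<close> satisfies \<open>(1 + t\<^sup>2) p' = (d t - m \<i>) p\<close>; hence \<open>p = (1 + \<i> t)\<^sup>a (1 - \<i> t)\<^sup>b\<close> with
  \<open>a + b = d\<close> and \<open>b - a = m\<close>. For the oriented degree of \<open>v\<close> this is a product over the edges at \<open>v\<close>,
  with factor \<open>1 - \<i> t\<close> for outgoing and \<open>1 + \<i> t\<close> for incoming edges. Expanding the product over all
  vertices means choosing a set of edges at every vertex; summed over the two directions of an edge,
  the weight is \<open>1 + 1\<close> or \<open>\<i> (-\<i>) + (-\<i>) \<i>\<close> if both ends agree on choosing it and \<open>\<i> - \<i>\<close> if they
  disagree, so that only the choices coming from edge subsets survive, each \<open>2\<^bsup>e(G)\<^esup>\<close> times.\<close>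

section \<open>Constants and linear forms in the polynomial ring\<close>

lemma const_0 [simp]: "const 0 = 0"
  by (simp add: const_def)

lemma const_1 [simp]: "const 1 = 1"
  by (simp add: const_def)

lemma const_add: "const (a + b) = const a + const b"
  by (simp add: const_def single_add)

lemma const_diff: "const (a - b) = const a - const b"
  by (simp add: const_def single_diff)

lemma const_mult: "const (a * b) = const a * const b"
  by (simp add: const_def mult_single)

lemma const_sum: "const (\<Sum>x\<in>A. f x) = (\<Sum>x\<in>A. const (f x))"
  by (induction A rule: infinite_finite_induct) (simp_all add: const_add)

lemma const_prod: "const (\<Prod>x\<in>A. f x) = (\<Prod>x\<in>A. const (f x))"
  by (induction A rule: infinite_finite_induct) (simp_all add: const_mult)

lemma const_mult_var: "const c * var k = Poly_Mapping.single (Poly_Mapping.single k 1) c"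
  by (simp add: const_def var_def mult_single)

lemma single_1_eq_iff:
  "Poly_Mapping.single j (1::nat) = Poly_Mapping.single k 1 \<longleftrightarrow> j = k"
proof
  assume "Poly_Mapping.single j (1::nat) = Poly_Mapping.single k 1"
  then have "Poly_Mapping.lookup (Poly_Mapping.single j (1::nat)) j
    = Poly_Mapping.lookup (Poly_Mapping.single k 1) j"
    by simp
  then show "j = k"
    by (simp add: lookup_single when_def split: if_splits)
qed simp

definition linear_poly :: "nat \<Rightarrow> (nat \<Rightarrow> complex) \<Rightarrow> cpoly" where
  "linear_poly d c = (\<Sum>k\<le>d. const (c k) * var k)"

lemma lookup_linear_poly:
  "Poly_Mapping.lookup (linear_poly d c) (Poly_Mapping.single j 1) = (if j \<le> d then c j else 0)"
  unfolding linear_poly_def const_mult_var lookup_sum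
  by (simp add: lookup_single when_def single_1_eq_iff[simplified])

lemma linear_poly_eq_iff: "linear_poly d a = linear_poly d b \<longleftrightarrow> (\<forall>k\<le>d. a k = b k)"
proof
  assume eq: "linear_poly d a = linear_poly d b"
  show "\<forall>k\<le>d. a k = b k"
  proof (intro allI impI)
    fix k assume "k \<le> d"
    then show "a k = b k"
      using lookup_linear_poly[of d a k] lookup_linear_poly[of d b k] eq by simp
  qed
qed (simp add: linear_poly_def)

lemma const_mult_linear_poly: "const a * linear_poly d c = linear_poly d (\<lambda>k. a * c k)"
  by (simp add: linear_poly_def sum_distrib_left const_mult mult.assoc)

lemma partial_deriv_linear_poly:
  assumes "k \<le> d"
  shows "partial_deriv k (linear_poly d c) = const (c k)"
proof -
  let ?P = "linear_poly d c" and ?S = "(\<lambda>j. Poly_Mapping.single j (1::nat)) ` {..d}"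
  let ?f = "\<lambda>m. Poly_Mapping.single (m - Poly_Mapping.single k 1)
       (of_nat (Poly_Mapping.lookup m k) * Poly_Mapping.lookup ?P m)"
  \<comment> \<open>The keys of \<open>?P\<close> omit every variable whose coefficient is zero; the
    sum is therefore enlarged to all monomials in \<open>?S\<close>, where the added terms
    vanish.\<close>
  have "Poly_Mapping.lookup ?P m = 0" if "m \<notin> ?S" for m
    using that unfolding linear_poly_def const_mult_var lookup_sum
    by (intro sum.neutral) (auto simp: lookup_single when_def)
  then have sub: "Poly_Mapping.keys ?P \<subseteq> ?S"
    by (meson in_keys_iff subsetI)
  have "partial_deriv k ?P = (\<Sum>m\<in>?S. ?f m)"
    unfolding partial_deriv_def using sub
    by (intro sum.mono_neutral_left) (auto simp: in_keys_iff)
  also have "\<dots> = (\<Sum>j\<le>d. ?f (Poly_Mapping.single j 1))"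
    by (rule sum.reindex_cong[of "\<lambda>j. Poly_Mapping.single j 1"])
       (auto simp: inj_on_def single_1_eq_iff[simplified])
  also have "\<dots> = (\<Sum>j\<le>d. if j = k then const (c k) else 0)"
  proof (intro sum.cong refl)
    fix j assume "j \<in> {..d}"
    then show "?f (Poly_Mapping.single j 1) = (if j = k then const (c k) else 0)"
      unfolding lookup_linear_poly by (simp add: lookup_single when_def const_def)
  qed
  also have "\<dots> = const (c k)"
    using assms by simp
  finally show ?thesis .
qed

section \<open>The derivation on linear forms and uniqueness of eigenforms\<close>

text \<open>The variable of index \<open>j\<close> arises from the neighbours \<open>j - 1\<close>
  and \<open>j + 1\<close>. The guards matter: \<open>0 - 1\<close> truncates to \<open>0\<close>,
  and \<open>c (d + 1)\<close> lies outside the form but may be nonzero.\<close>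

definition deriv_coeff :: "nat \<Rightarrow> (nat \<Rightarrow> complex) \<Rightarrow> nat \<Rightarrow> complex" where
  "deriv_coeff d c j = (if j = 0 then 0 else of_nat (d - (j - 1)) * c (j - 1))
     - (if j = d then 0 else of_nat (j + 1) * c (j + 1))"

lemma derivation_linear_poly:
  "derivation d (linear_poly d c) = linear_poly d (deriv_coeff d c)"
proof -
  let ?up = "\<lambda>j. const (if j = 0 then 0 else of_nat (d - (j - 1)) * c (j - 1)) * var j"
  let ?down = "\<lambda>j. const (if j = d then 0 else of_nat (j + 1) * c (j + 1)) * var j"
  \<comment> \<open>The factor \<open>d - k\<close> kills the term \<open>k = d\<close>; the rest is
    reindexed by the variable produced. The second sum likewise loses its term
    \<open>k = 0\<close>.\<close>
  have "(\<Sum>k\<le>d. const (of_nat (d - k) * c k) * var (k + 1))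
      = (\<Sum>k<d. const (of_nat (d - k) * c k) * var (k + 1))"
    by (simp flip: lessThan_Suc_atMost)
  also have "\<dots> = (\<Sum>k<d. ?up (Suc k))"
    by simp
  also have "\<dots> = (\<Sum>j\<le>d. ?up j)"
    by (subst sum.atMost_shift) simp
  finally have up: "(\<Sum>k\<le>d. const (of_nat (d - k) * c k) * var (k + 1)) = (\<Sum>j\<le>d. ?up j)" .
  have "(\<Sum>k\<le>d. const (of_nat k * c k) * var (k - 1))
      = (\<Sum>k<d. const (of_nat (Suc k) * c (Suc k)) * var k)"
    by (subst sum.atMost_shift) simp
  also have "\<dots> = (\<Sum>j<d. ?down j)"
    by (intro sum.cong) auto
  also have "\<dots> = (\<Sum>j\<le>d. ?down j)"
    by (simp flip: lessThan_Suc_atMost)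
  finally have down: "(\<Sum>k\<le>d. const (of_nat k * c k) * var (k - 1)) = (\<Sum>j\<le>d. ?down j)" .
  have "derivation d (linear_poly d c) = (\<Sum>k\<le>d. const (of_nat (d - k) * c k) * var (k + 1))
      - (\<Sum>k\<le>d. const (of_nat k * c k) * var (k - 1))"
    unfolding derivation_def sum_subtractf[symmetric]
    by (intro sum.cong refl)
      (simp only: partial_deriv_linear_poly atMost_iff const_mult algebra_simps)
  also have "\<dots> = linear_poly d (deriv_coeff d c)"
    unfolding up down sum_subtractf[symmetric] linear_poly_def deriv_coeff_def const_diff
      left_diff_distrib ..
  finally show ?thesis .
qed

lemma is_eigenform_linear_poly_iff:
  "is_eigenform d m (linear_poly d c) \<longleftrightarrow>
     c 0 = 1 \<and> (\<forall>j\<le>d. deriv_coeff d c j = of_int m * \<i> * c j)"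
  using lookup_linear_poly[of d c 0]
  by (auto simp: is_eigenform_def derivation_linear_poly const_mult_linear_poly
      linear_poly_eq_iff linear_form_def linear_poly_def[symmetric])

text \<open>The eigenvalue equation at index \<open>j < d\<close> expresses
  \<open>(j + 1) * c (j + 1)\<close> through \<open>c j\<close> and \<open>c (j - 1)\<close>, so the
  normalization \<open>c 0 = 1\<close> determines all coefficients. Any eigenform found is thus the
  one denoted by \<open>eigenform\<close>.\<close>

lemma is_eigenform_unique:
  assumes "is_eigenform d m P" and "is_eigenform d m Q"
  shows "P = Q"
proof -
  obtain a b where P: "P = linear_poly d a" and Q: "Q = linear_poly d b"
    using assms by (auto simp: is_eigenform_def linear_form_def linear_poly_def)
  have a: "a 0 = 1" "\<And>j. j \<le> d \<Longrightarrow> deriv_coeff d a j = of_int m * \<i> * a j"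
    and b: "b 0 = 1" "\<And>j. j \<le> d \<Longrightarrow> deriv_coeff d b j = of_int m * \<i> * b j"
    using assms unfolding P Q is_eigenform_linear_poly_iff by auto
  have "k \<le> d \<longrightarrow> a k = b k" for k
  proof (induction k rule: less_induct)
    case (less k)
    show ?case
    proof (cases k)
      case 0
      then show ?thesis by (simp add: a b)
    next
      case (Suc j)
      show ?thesis
      proof
        assume k: "k \<le> d"
        have "a j = b j" "a (j - 1) = b (j - 1)"
          using less Suc k by simp_all
        moreover from this have "deriv_coeff d a j = deriv_coeff d b j"
          using a(2)[of j] b(2)[of j] Suc k by simp
        ultimately have "of_nat (Suc j) * a (Suc j) = of_nat (Suc j) * b (Suc j)"
          using Suc k by (cases "j = 0") (simp_all add: deriv_coeff_def del: of_nat_Suc)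
        then show "a k = b k"
          unfolding Suc by (simp del: of_nat_Suc)
      qed
    qed
  qed
  then show ?thesis
    unfolding P Q linear_poly_eq_iff by blast
qed

section \<open>Generating functions of eigenforms\<close>

text \<open>This is logarithmic differentiation without division. Since s^2 = -1, the factor 1 + s t
  divides 1 + t^2 with quotient 1 - s t, and its contribution s (1 - s t) equals s + t.\<close>

lemma pderiv_prod_linear_factors:
  fixes s :: "'a \<Rightarrow> complex"
  assumes "finite E" and "\<And>e. e \<in> E \<Longrightarrow> s e * s e = -1"
  shows "[:1, 0, 1:] * pderiv (\<Prod>e\<in>E. [:1, s e:])
    = [:\<Sum>e\<in>E. s e, of_nat (card E):] * (\<Prod>e\<in>E. [:1, s e:])"
  using assms
proof (induction E rule: finite_induct)
  case empty
  then show ?case by simp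
next
  case (insert x E)
  let ?p = "\<Prod>e\<in>E. [:1, s e:]"
  have fac: "[:1, 0, 1:] = [:1, s x:] * [:1, - s x:]"
    using insert.prems by simp
  have "[:1, 0, 1:] * pderiv ([:1, s x:] * ?p)
      = [:1, s x:] * ([:1, 0, 1:] * pderiv ?p) + [:1, 0, 1:] * [:s x:] * ?p"
    by (simp add: pderiv_mult pderiv_pCons algebra_simps del: mult_pCons_left mult_pCons_right)
  also have "\<dots> = [:1, s x:] * ([:\<Sum>e\<in>E. s e, of_nat (card E):] * ?p)
      + [:1, s x:] * [:1, - s x:] * [:s x:] * ?p"
    using insert by (simp only: fac) simp
  also have "\<dots> = ([:\<Sum>e\<in>E. s e, of_nat (card E):] + [:1, - s x:] * [:s x:]) * ([:1, s x:] * ?p)"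
    by (simp only: algebra_simps)
  also have "[:1, - s x:] * [:s x:] = [:s x, 1:]"
    using insert.prems by simp
  finally show ?case
    using insert.hyps by (simp add: add.commute)
qed

text \<open>The coefficients of the product of the 1 + s_e t solve the recurrence. Keeping the
  product indexed by \<open>E\<close>, instead of collecting equal factors, makes its expansion a
  sum over subsets.\<close>

lemma eigenform_eq:
  fixes s :: "'a \<Rightarrow> complex"
  assumes fin: "finite E" and sq: "\<And>e. e \<in> E \<Longrightarrow> s e * s e = -1"
    and sum: "(\<Sum>e\<in>E. s e) = - of_int m * \<i>" and card: "card E = d"
  shows "eigenform d m = (\<Sum>S\<in>Pow E. const (\<Prod>e\<in>S. s e) * var (card S))"
proof -
  define p where "p = (\<Prod>e\<in>E. [:1, s e:])"
  have "p = (\<Prod>e\<in>E. monom (s e) 1 + 1)"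
    unfolding p_def by (simp add: monom_Suc monom_0 one_pCons)
  also have "\<dots> = (\<Sum>S\<in>Pow E. \<Prod>e\<in>S. monom (s e) 1)"
    using fin by (simp add: prod_add)
  also have "\<dots> = (\<Sum>S\<in>Pow E. monom (\<Prod>e\<in>S. s e) (card S))"
  proof (intro sum.cong refl)
    fix S assume "S \<in> Pow E"
    then have "finite S"
      using fin finite_subset by blast
    then show "(\<Prod>e\<in>S. monom (s e) 1) = monom (\<Prod>e\<in>S. s e) (card S)"
      by (induction S rule: finite_induct) (simp_all add: mult_monom)
  qed
  finally have p: "p = (\<Sum>S\<in>Pow E. monom (\<Prod>e\<in>S. s e) (card S))" .
  have coeff_p: "coeff p k = (\<Sum>S\<in>Pow E. if card S = k then \<Prod>e\<in>S. s e else 0)" for k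
    unfolding p coeff_sum by simp
  have card_le: "card S \<le> d" if "S \<in> Pow E" for S
    using that fin card by (auto intro: card_mono)
  have coeff_0: "coeff p 0 = 1"
    by (simp add: p_def poly_prod flip: poly_0_coeff_0)
  \<comment> \<open>At \<open>j = d\<close> the differential equation involves this coefficient,
    while \<open>deriv_coeff\<close> drops it.\<close>
  have coeff_top: "coeff p (Suc d) = 0"
    unfolding coeff_p using card_le by (intro sum.neutral ballI if_not_P) (metis Suc_n_not_le_n)
  have ode: "[:1, 0, 1:] * pderiv p = [:- of_int m * \<i>, of_nat d:] * p"
    using pderiv_prod_linear_factors[of E s, OF fin sq] unfolding p_def sum card .
  have "deriv_coeff d (coeff p) j = of_int m * \<i> * coeff p j" if "j \<le> d" for j
  proof -
    \<comment> \<open>For j > 0 this reads (j+1) c_{j+1} + (j-1) c_{j-1} = -m i c_j + d c_{j-1},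
      which rearranges to the recurrence.\<close>
    have eq: "coeff ([:1, 0, 1:] * pderiv p) j = coeff ([:- of_int m * \<i>, of_nat d:] * p) j"
      by (simp only: ode)
    have "deriv_coeff d (coeff p) j
      = (if j = 0 then 0 else of_nat (d - (j - 1)) * coeff p (j - 1)) - of_nat (j + 1) * coeff p (j + 1)"
      using coeff_top by (simp add: deriv_coeff_def)
    also have "\<dots> = of_int m * \<i> * coeff p j"
    proof (cases j)
      case zero: 0
      show ?thesis
        using eq unfolding zero by (simp add: coeff_pderiv)
    next
      case j: (Suc i)
      have d: "of_nat d = (of_nat i + of_nat (d - i) :: complex)"
        using \<open>j \<le> d\<close> j by (simp flip: of_nat_add)
      then show ?thesis
        using eq unfolding j d
        by (cases i) (simp_all add: coeff_pderiv algebra_simps)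
    qed
    finally show ?thesis .
  qed
  then have "is_eigenform d m (linear_poly d (coeff p))"
    by (simp add: is_eigenform_linear_poly_iff coeff_0)
  then have "eigenform d m = linear_poly d (coeff p)"
    unfolding eigenform_def by (blast intro: is_eigenform_unique)
  \<comment> \<open>The subsets are grouped by cardinality; after the swap each \<open>S\<close>
    meets exactly one \<open>k\<close>, because \<open>card S \<le> d\<close>.\<close>
  also have "\<dots> = (\<Sum>k\<le>d. \<Sum>S\<in>Pow E. if card S = k then const (\<Prod>e\<in>S. s e) * var k else 0)"
    unfolding linear_poly_def coeff_p const_sum sum_distrib_right
    by (intro sum.cong refl) simp
  also have "\<dots> = (\<Sum>S\<in>Pow E. \<Sum>k\<le>d. if card S = k then const (\<Prod>e\<in>S. s e) * var k else 0)"
    by (rule sum.swap)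
  also have "\<dots> = (\<Sum>S\<in>Pow E. const (\<Prod>e\<in>S. s e) * var (card S))"
    using card_le by (intro sum.cong refl) simp
  finally show ?thesis .
qed

section \<open>Edge weights and summation over orientations\<close>

text \<open>The signs make the weights at a vertex sum to -i times its oriented degree, as
  \<open>eigenform_eq\<close> requires. Only the two ends of an edge are meant as \<open>v\<close>;
  anything but the tail counts as the head.\<close>

definition end_weight :: "'v \<times> 'v \<Rightarrow> 'v \<Rightarrow> complex" where
  "end_weight p v = (if fst p = v then - \<i> else \<i>)"

lemma eigenform_oriented_degree:
  assumes G: "finite_graph G" and "regular d G" and \<O>: "\<O> \<in> orientations G" and v: "v \<in> verts G"
  shows "eigenform d (oriented_degree G \<O> v) =
    (\<Sum>S\<in>Pow {e \<in> edges G. v \<in> ends G e}.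
       const (\<Prod>e\<in>S. end_weight (\<O> e) v) * var (card S))"
proof (rule eigenform_eq)
  let ?out = "{e \<in> edges G. fst (\<O> e) = v}" and ?in = "{e \<in> edges G. snd (\<O> e) = v}"
  show "finite {e \<in> edges G. v \<in> ends G e}"
    using G by (simp add: finite_graph_def)
  show "end_weight (\<O> e) v * end_weight (\<O> e) v = - 1" for e
    by (simp add: end_weight_def)
  show "card {e \<in> edges G. v \<in> ends G e} = d"
    using assms by (simp add: regular_def degree_in_def)
  have ends: "ends G e = {fst (\<O> e), snd (\<O> e)}" if "e \<in> edges G" for e
    using \<O> that unfolding orientations_def by (force dest: PiE_mem)
  \<comment> \<open>Having two distinct ends, no edge is both outgoing and incoming at
    \<open>v\<close>.\<close>
  have distinct: "fst (\<O> e) \<noteq> snd (\<O> e)" if "e \<in> edges G" for e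
    using ends[OF that] G that by (auto simp: finite_graph_def)
  have disjoint: "?out \<inter> ?in = {}"
  proof (rule equals0I)
    fix e assume "e \<in> ?out \<inter> ?in"
    then show False
      using distinct[of e] by simp
  qed
  have split: "{e \<in> edges G. v \<in> ends G e} = ?out \<union> ?in"
    using ends by auto
  have fin: "finite ?out" "finite ?in"
    using G by (simp_all add: finite_graph_def)
  have "(\<Sum>e\<in>{e \<in> edges G. v \<in> ends G e}. end_weight (\<O> e) v)
      = (\<Sum>e\<in>?out. end_weight (\<O> e) v) + (\<Sum>e\<in>?in. end_weight (\<O> e) v)"
    unfolding split using fin disjoint by (rule sum.union_disjoint)
  also have "(\<Sum>e\<in>?out. end_weight (\<O> e) v) = (\<Sum>e\<in>?out. - \<i>)"
    by (intro sum.cong) (auto simp: end_weight_def)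
  also have "(\<Sum>e\<in>?in. end_weight (\<O> e) v) = (\<Sum>e\<in>?in. \<i>)"
    using distinct by (intro sum.cong) (auto simp: end_weight_def)
  finally show "(\<Sum>e\<in>{e \<in> edges G. v \<in> ends G e}. end_weight (\<O> e) v)
      = - of_int (oriented_degree G \<O> v) * \<i>"
    by (simp add: oriented_degree_def algebra_simps)
qed

text \<open>Here \<open>P v\<close> records whether the edge with ends \<open>X\<close> is chosen at
  \<open>v\<close>. Reversing the edge swaps the weights -i and i, which cancel exactly when one end
  alone chooses it.\<close>

lemma sum_directions:
  assumes "card X = 2"
  shows "(\<Sum>p\<in>{(u, w). X = {u, w}}. \<Prod>v\<in>X. if P v then end_weight p v else 1)
    = (if \<forall>v\<in>X. \<forall>w\<in>X. P v = P w then 2 else 0)"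
proof -
  obtain a b where X: "X = {a, b}" "a \<noteq> b"
    using assms by (meson card_2_iff)
  have "{(u, w). X = {u, w}} = {(a, b), (b, a)}"
    using X by (auto simp: doubleton_eq_iff)
  then have "(\<Sum>p\<in>{(u, w). X = {u, w}}. \<Prod>v\<in>X. if P v then end_weight p v else 1)
      = (\<Sum>p\<in>{(a, b), (b, a)}. \<Prod>v\<in>{a, b}. if P v then end_weight p v else 1)"
    by (simp only: X(1))
  also have "\<dots> = (if P a = P b then 2 else 0)"
    using X(2) X(2)[symmetric] by (cases "P a"; cases "P b") (simp_all add: end_weight_def)
  also have "\<dots> = (if \<forall>v\<in>X. \<forall>w\<in>X. P v = P w then 2 else 0)"
    unfolding X(1) by (rule if_cong) auto
  finally show ?thesis .
qed

text \<open>For fixed choices \<open>g\<close> the weight factors over the edges, and each factor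
  depends only on the direction of its own edge; the sum over orientations is thus a product of
  local sums.\<close>

lemma sum_orientations:
  assumes G: "finite_graph G"
    and g: "g \<in> (\<Pi>\<^sub>E v\<in>verts G. Pow {e \<in> edges G. v \<in> ends G e})"
  shows "(\<Sum>\<O>\<in>orientations G. \<Prod>v\<in>verts G. \<Prod>e\<in>g v. end_weight (\<O> e) v)
    = (if \<forall>e\<in>edges G. \<forall>v\<in>ends G e. \<forall>w\<in>ends G e. e \<in> g v \<longleftrightarrow> e \<in> g w
       then 2 ^ card (edges G) else 0)"
proof -
  let ?D = "\<lambda>e. {(u, w). ends G e = {u, w}}"
  let ?x = "\<lambda>e p v. if e \<in> g v then end_weight p v else (1::complex)"
  have finV: "finite (verts G)" and finE: "finite (edges G)"
    and ends_sub: "\<And>e. e \<in> edges G \<Longrightarrow> ends G e \<subseteq> verts G"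
    and card_ends: "\<And>e. e \<in> edges G \<Longrightarrow> card (ends G e) = 2"
    using G by (auto simp: finite_graph_def)
  have g_sub: "g v \<subseteq> {e \<in> edges G. v \<in> ends G e}" if "v \<in> verts G" for v
    using PiE_mem[OF g that] by simp
  have finD: "finite (?D e)" if "e \<in> edges G" for e
  proof (rule finite_subset)
    show "?D e \<subseteq> verts G \<times> verts G"
      using ends_sub[OF that] by auto
  qed (simp add: finV)
  have "(\<Prod>v\<in>verts G. \<Prod>e\<in>g v. end_weight (\<O> e) v)
      = (\<Prod>e\<in>edges G. \<Prod>v\<in>ends G e. ?x e (\<O> e) v)" for \<O>
  proof -
    \<comment> \<open>Padding with factors 1 gives all vertices the same index set, so that the
      products can be swapped.\<close>
    have "(\<Prod>v\<in>verts G. \<Prod>e\<in>g v. end_weight (\<O> e) v)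
        = (\<Prod>v\<in>verts G. \<Prod>e\<in>edges G. ?x e (\<O> e) v)"
    proof (rule prod.cong[OF refl])
      fix v assume "v \<in> verts G"
      then have "g v \<subseteq> edges G"
        using g_sub by fast
      then show "(\<Prod>e\<in>g v. end_weight (\<O> e) v) = (\<Prod>e\<in>edges G. ?x e (\<O> e) v)"
        using finE by (intro prod.mono_neutral_cong_left) simp_all
    qed
    also have "\<dots> = (\<Prod>e\<in>edges G. \<Prod>v\<in>verts G. ?x e (\<O> e) v)"
      by (rule prod.swap)
    also have "\<dots> = (\<Prod>e\<in>edges G. \<Prod>v\<in>ends G e. ?x e (\<O> e) v)"
    proof (rule prod.cong[OF refl])
      fix e assume "e \<in> edges G"
      moreover have "e \<notin> g v" if "v \<in> verts G - ends G e" for v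
        using g_sub[of v] that by blast
      ultimately show "(\<Prod>v\<in>verts G. ?x e (\<O> e) v) = (\<Prod>v\<in>ends G e. ?x e (\<O> e) v)"
        using finV ends_sub by (intro prod.mono_neutral_right) simp_all
    qed
    finally show ?thesis .
  qed
  then have "(\<Sum>\<O>\<in>orientations G. \<Prod>v\<in>verts G. \<Prod>e\<in>g v. end_weight (\<O> e) v)
      = (\<Sum>\<O>\<in>orientations G. \<Prod>e\<in>edges G. \<Prod>v\<in>ends G e. ?x e (\<O> e) v)"
    by simp
  \<comment> \<open>Orientations are independent choices of directions, so this is the distributive
    law.\<close>
  also have "\<dots> = (\<Prod>e\<in>edges G. \<Sum>p\<in>?D e. \<Prod>v\<in>ends G e. ?x e p v)"
    unfolding orientations_def using finE finD by (rule prod_sum_PiE[symmetric])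
  also have "\<dots> = (\<Prod>e\<in>edges G.
      if \<forall>v\<in>ends G e. \<forall>w\<in>ends G e. e \<in> g v \<longleftrightarrow> e \<in> g w then 2 else 0)"
    by (intro prod.cong refl sum_directions card_ends)
  also have "\<dots> = (if \<forall>e\<in>edges G. \<forall>v\<in>ends G e. \<forall>w\<in>ends G e. e \<in> g v \<longleftrightarrow> e \<in> g w
      then 2 ^ card (edges G) else 0)"
  proof (cases "\<forall>e\<in>edges G. \<forall>v\<in>ends G e. \<forall>w\<in>ends G e. e \<in> g v \<longleftrightarrow> e \<in> g w")
    case True
    then have "(\<Prod>e\<in>edges G.
        if \<forall>v\<in>ends G e. \<forall>w\<in>ends G e. e \<in> g v \<longleftrightarrow> e \<in> g w then 2 else 0)
        = (\<Prod>e\<in>edges G. 2 :: complex)"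
      by (intro prod.cong refl if_P) blast
    then show ?thesis
      by (simp only: if_P[OF True] prod_constant)
  next
    case False
    then have "\<exists>e\<in>edges G.
        (if \<forall>v\<in>ends G e. \<forall>w\<in>ends G e. e \<in> g v \<longleftrightarrow> e \<in> g w then 2 else 0) = (0 :: complex)"
      by (meson if_not_P)
    then show ?thesis
      by (simp only: if_not_P[OF False] prod_zero[OF finE])
  qed
  finally show ?thesis .
qed

text \<open>An edge subset is recovered as the union of its local parts, since every edge has an
  end. Conversely, agreement at both ends ensures that the union adds nothing to any
  \<open>g v\<close>.\<close>

lemma consistent_choices:
  assumes G: "finite_graph G"
  shows "bij_betw (\<lambda>A. \<lambda>v\<in>verts G. {e \<in> A. v \<in> ends G e}) (Pow (edges G))
    {g \<in> \<Pi>\<^sub>E v\<in>verts G. Pow {e \<in> edges G. v \<in> ends G e}.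
       \<forall>e\<in>edges G. \<forall>v\<in>ends G e. \<forall>w\<in>ends G e. e \<in> g v \<longleftrightarrow> e \<in> g w}"
    (is "bij_betw ?h _ ?C")
proof (rule bij_betw_byWitness[where f' = "\<lambda>g. \<Union>v\<in>verts G. g v"])
  have ends_sub: "ends G e \<subseteq> verts G" if "e \<in> edges G" for e
    using G that by (auto simp: finite_graph_def)
  have ends_ne: "ends G e \<noteq> {}" if "e \<in> edges G" for e
    using G that by (auto simp: finite_graph_def)
  show "\<forall>A\<in>Pow (edges G). (\<Union>v\<in>verts G. ?h A v) = A"
  proof
    fix A assume "A \<in> Pow (edges G)"
    then have "\<exists>v\<in>verts G. v \<in> ends G e" if "e \<in> A" for e
      using ends_sub[of e] ends_ne[of e] that by blast
    then show "(\<Union>v\<in>verts G. ?h A v) = A"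
      by simp blast
  qed
  show "\<forall>g\<in>?C. ?h (\<Union>v\<in>verts G. g v) = g"
  proof (intro ballI ext)
    fix g v assume g: "g \<in> ?C"
    then have PiE: "g \<in> (\<Pi>\<^sub>E v\<in>verts G. Pow {e \<in> edges G. v \<in> ends G e})"
      and agree: "e \<in> g u \<Longrightarrow> e \<in> edges G \<Longrightarrow> u \<in> ends G e \<Longrightarrow> w \<in> ends G e \<Longrightarrow> e \<in> g w" for e u w
      by blast+
    have g_sub: "g u \<subseteq> {e \<in> edges G. u \<in> ends G e}" if "u \<in> verts G" for u
      using PiE_mem[OF PiE that] by simp
    show "?h (\<Union>v\<in>verts G. g v) v = g v"
    proof (cases "v \<in> verts G")
      case True
      have "e \<in> g v" if "u \<in> verts G" "e \<in> g u" "v \<in> ends G e" for e u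
        using agree[of e u v] g_sub[OF that(1)] that by blast
      moreover have "v \<in> ends G e" if "e \<in> g v" for e
        using g_sub[OF True] that by blast
      ultimately show ?thesis
        using True by (simp only: restrict_apply if_True) blast
    next
      \<comment> \<open>Off the vertex set both functions are \<open>undefined\<close>.\<close>
      case False
      then show ?thesis
        using PiE_arb[OF PiE] by simp
    qed
  qed
  show "?h ` Pow (edges G) \<subseteq> ?C"
    using ends_sub by (auto simp: subset_iff)
  show "(\<lambda>g. \<Union>v\<in>verts G. g v) ` ?C \<subseteq> Pow (edges G)"
    by blast
qed

section \<open>Expansion over the vertices and exchange of sums\<close>

theorem theorem4p2:
  fixes G :: "('v, 'e) graph" and d :: nat
  assumes "finite_graph G" and "regular d G"
  shows "subgraph_poly G =
    const (1 / 2 ^ card (edges G)) *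
      (\<Sum>\<O>\<in>orientations G. \<Prod>v\<in>verts G. eigenform d (oriented_degree G \<O> v))"
proof -
  let ?I = "\<lambda>v. Pow {e \<in> edges G. v \<in> ends G e}"
  let ?F = "\<Pi>\<^sub>E v\<in>verts G. ?I v"
  let ?ok = "\<lambda>g. \<forall>e\<in>edges G. \<forall>v\<in>ends G e. \<forall>w\<in>ends G e. e \<in> g v \<longleftrightarrow> e \<in> g w"
  let ?N = "2 ^ card (edges G) :: complex"
  let ?X = "\<lambda>g. \<Prod>v\<in>verts G. var (card (g v))"
  have finV: "finite (verts G)" and finI: "\<And>v. finite (?I v)"
    using assms by (auto simp: finite_graph_def)
  have finF: "finite ?F"
    using finV finI by (rule finite_PiE)
  have "(\<Sum>\<O>\<in>orientations G. \<Prod>v\<in>verts G. eigenform d (oriented_degree G \<O> v))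
      = (\<Sum>\<O>\<in>orientations G. \<Prod>v\<in>verts G.
          \<Sum>S\<in>?I v. const (\<Prod>e\<in>S. end_weight (\<O> e) v) * var (card S))"
    using assms by (intro sum.cong prod.cong refl eigenform_oriented_degree)
  \<comment> \<open>Multiplying out picks an edge set \<open>g v\<close> at every vertex.\<close>
  also have "\<dots> = (\<Sum>\<O>\<in>orientations G. \<Sum>g\<in>?F. \<Prod>v\<in>verts G.
      const (\<Prod>e\<in>g v. end_weight (\<O> e) v) * var (card (g v)))"
    by (intro sum.cong refl prod_sum_PiE finV finI)
  also have "\<dots> = (\<Sum>g\<in>?F. \<Sum>\<O>\<in>orientations G. \<Prod>v\<in>verts G.
      const (\<Prod>e\<in>g v. end_weight (\<O> e) v) * var (card (g v)))"
    by (rule sum.swap)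
  \<comment> \<open>The monomial depends only on \<open>g\<close>, so the orientations enter through
    a scalar sum alone.\<close>
  also have "\<dots> = (\<Sum>g\<in>?F.
      const (\<Sum>\<O>\<in>orientations G. \<Prod>v\<in>verts G. \<Prod>e\<in>g v. end_weight (\<O> e) v) * ?X g)"
    by (simp only: const_sum const_prod sum_distrib_right prod.distrib)
  also have "\<dots> = (\<Sum>g\<in>?F. if ?ok g then const ?N * ?X g else 0)"
  proof (rule sum.cong[OF refl])
    fix g assume "g \<in> ?F"
    then show "const (\<Sum>\<O>\<in>orientations G. \<Prod>v\<in>verts G. \<Prod>e\<in>g v. end_weight (\<O> e) v) * ?X g
        = (if ?ok g then const ?N * ?X g else 0)"
      by (simp only: sum_orientations[OF assms(1)] if_distrib[of const]
          if_distrib[of "\<lambda>c. c * ?X g"] const_0 mult_zero_left)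
  qed
  also have "\<dots> = (\<Sum>g\<in>{g \<in> ?F. ?ok g}. const ?N * ?X g)"
    using finF by (rule sum.inter_filter[symmetric])
  \<comment> \<open>For the choices coming from \<open>A\<close>, the size of the local part at
    \<open>v\<close> is the degree of \<open>v\<close> in \<open>A\<close>.\<close>
  also have "\<dots> = (\<Sum>A\<in>Pow (edges G). const ?N * ?X (\<lambda>v\<in>verts G. {e \<in> A. v \<in> ends G e}))"
    by (rule sum.reindex_bij_betw[OF consistent_choices[OF assms(1)], symmetric])
  also have "\<dots> = const ?N * subgraph_poly G"
    by (simp add: subgraph_poly_def degree_in_def sum_distrib_left)
  finally show ?thesis
    by (simp add: mult.assoc[symmetric] const_mult[symmetric])
qed

end
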